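(* The optimization problem $\mathscr{P}_2$ in the variables $(x_k,\rho_k)_{k=1}^K$, with $\rho_k\in(0,1]$ and $x_k\in(0,1]$, $$\min_{\{x_k,\rho_k\}}\ \sum_{k=1}^K\frac{|\mathcal{D}_k|}{|\mathcal{D}|}\frac{1}{x_k^2}$$ subject to, for all $k\in\{1,\dots,K\}$, $$\mathcal{C}_1:\ \frac{x_k^2M_{\rm ori}Q}{\rho_kB}\left(\frac{1}{R_k^{\rm dl}}+\frac{1}{R_k^{\rm ul}}\right)+\frac{x_k^2C_{\rm ori}|\mathcal{D}_k|}{f_k}\le T_0,$$ $$\mathcal{C}_2:\ \frac{x_k^2M_{\rm ori}Q\,P_k^{\rm com,ul}}{\rho_kBR_k^{\rm ul}}+x_k^2C_{\rm ori}\Omega_k|\mathcal{D}_k|f_k^2+\xi_k\le E_{k,0},$$ $$\mathcal{C}_3:\ \sum_{k=1}^K\rho_k\le1,\quad\rho_k\ge0,$$ $$\mathcal{C}_4:\ 0\le 1-x_k^2<\theta,$$ is a convex optimization problem, i.e. its objective function is convex and each of the constraints $\mathcal{C}_1,\dots,\mathcal{C}_4$ defines a convex set.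
   Context: The problem is a joint design of dropout rates and bandwidth allocation for $K$ devices in one training round. $x_k=\sqrt{1-\gamma_k}$, where $\gamma_k$ is the dropout rate of device $k$, and $\rho_k$ is the fraction of total bandwidth allocated to device $k$. All other quantities are given constants: $|\mathcal{D}_k|>0$ (local dataset size), $|\mathcal{D}|=\sum_k|\mathcal{D}_k|$, $M_{\rm ori}>0$ (number of parameters of the original network), $C_{\rm ori}>0$ (processor operations per sample for the original network), $Q>0$ (quantization bits per parameter), $B>0$ (total bandwidth), $R_k^{\rm dl},R_k^{\rm ul}>0$ (downlink and uplink spectrum efficiencies), $P_k^{\rm com,ul}\geq 0$ (uplink transmit power), $f_k>0$ (CPU frequency), $\Omega_k>0$ (CPU constant), $\xi_k\ge0$ (circuit energy), $T_0>0$ (maximum round latency), $E_{k,0}>0$ (energy budget), and $\theta\in(0,1]$ (maximum dropout rate). The subnet of device $k$ has $M_k=x_k^2M_{\rm ori}$ parameters and requires $C_k=x_k^2C_{\rm ori}$ operations per sample. *)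

theory Defs
  imports "HOL-Analysis.Analysis"
begin

(* A minimization problem is given by the set X on which its variables range, its objective f
   and the collection Cs of its constraints. Each constraint is considered on X; note that
   convex_on X f includes the convexity of X. *)

definition convex_optimization_problem ::
  "'v::real_vector set \<Rightarrow> ('v \<Rightarrow> real) \<Rightarrow> ('v \<Rightarrow> bool) set \<Rightarrow> bool"
  where "convex_optimization_problem X f Cs \<longleftrightarrow>
    convex_on X f \<and> (\<forall>C\<in>Cs. convex {z \<in> X. C z})"

(* The devices are the elements of the finite type 'k; the variables are the pairs (x, \<rho>). *)

type_synonym 'k vars = "(real ^ 'k) \<times> (real ^ 'k)"

definition P2_domain :: "'k::finite vars set"
  where "P2_domain = {(x, \<rho>). \<forall>k. x $ k \<in> {0<..1} \<and> \<rho> $ k \<in> {0<..1}}"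

definition P2_objective :: "('k::finite \<Rightarrow> real) \<Rightarrow> 'k vars \<Rightarrow> real"
  where "P2_objective D = (\<lambda>(x, \<rho>). \<Sum>k\<in>UNIV. D k / (\<Sum>j\<in>UNIV. D j) * (1 / (x $ k)\<^sup>2))"

definition P2_C1 ::
  "real \<Rightarrow> real \<Rightarrow> real \<Rightarrow> real \<Rightarrow> ('k::finite \<Rightarrow> real) \<Rightarrow> ('k \<Rightarrow> real) \<Rightarrow> ('k \<Rightarrow> real) \<Rightarrow> ('k \<Rightarrow> real) \<Rightarrow>
    real \<Rightarrow> 'k \<Rightarrow> 'k vars \<Rightarrow> bool"
  where "P2_C1 M_ori C_ori Q B D R_dl R_ul f T0 k = (\<lambda>(x, \<rho>).
    ((x $ k)\<^sup>2 * M_ori * Q) / (\<rho> $ k * B) * (1 / R_dl k + 1 / R_ul k)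
      + ((x $ k)\<^sup>2 * C_ori * D k) / f k \<le> T0)"

definition P2_C2 ::
  "real \<Rightarrow> real \<Rightarrow> real \<Rightarrow> real \<Rightarrow> ('k::finite \<Rightarrow> real) \<Rightarrow> ('k \<Rightarrow> real) \<Rightarrow> ('k \<Rightarrow> real) \<Rightarrow> ('k \<Rightarrow> real) \<Rightarrow>
    ('k \<Rightarrow> real) \<Rightarrow> ('k \<Rightarrow> real) \<Rightarrow> ('k \<Rightarrow> real) \<Rightarrow> 'k \<Rightarrow> 'k vars \<Rightarrow> bool"
  where "P2_C2 M_ori C_ori Q B D R_ul P_ul f \<Omega> \<xi> E0 k = (\<lambda>(x, \<rho>).
    ((x $ k)\<^sup>2 * M_ori * Q * P_ul k) / (\<rho> $ k * B * R_ul k)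
      + (x $ k)\<^sup>2 * C_ori * \<Omega> k * D k * (f k)\<^sup>2 + \<xi> k \<le> E0 k)"

definition P2_C3 :: "'k::finite \<Rightarrow> 'k vars \<Rightarrow> bool"
  where "P2_C3 k = (\<lambda>(x, \<rho>). (\<Sum>j\<in>UNIV. \<rho> $ j) \<le> 1 \<and> \<rho> $ k \<ge> 0)"

definition P2_C4 :: "real \<Rightarrow> 'k::finite \<Rightarrow> 'k vars \<Rightarrow> bool"
  where "P2_C4 \<theta> k = (\<lambda>(x, \<rho>). 0 \<le> 1 - (x $ k)\<^sup>2 \<and> 1 - (x $ k)\<^sup>2 < \<theta>)"

end

(* The summands 1/x\<^sup>2 of the objective are convex for x > 0. Since \<rho> > 0 on the domain, C1 and C2
   are sublevel sets of a x\<^sup>2/\<rho> + b x\<^sup>2 with a, b \<ge> 0, where the quadratic-over-linear function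
   x\<^sup>2/\<rho> is jointly convex by Cauchy-Schwarz. Positivity of x turns C4 into the linear constraint
   sqrt (1 - \<theta>) < x. *)

theory Submission
  imports Defs
begin

text \<open>A linear \<open>g\<close> commutes with convex combinations, so the inequality for
  \<open>f\<close> at \<open>g x\<close>, \<open>g y\<close> is the one needed at \<open>x\<close>,
  \<open>y\<close>. This lifts functions of one or two real coordinates to the full space of
  variables.\<close>

lemma convex_on_linear_vimage:
  assumes "convex_on S f" and "linear g" and "convex T" and "g ` T \<subseteq> S"
  shows "convex_on T (\<lambda>x. f (g x))"
proof -
  interpret g: linear g by fact
  show ?thesis
    using assms unfolding convex_on_def
    by (auto simp: g.add g.scaleR image_subset_iff)
qed

text \<open>Convexity of \<open>S\<close> is a separate hypothesis for the sake of empty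
  \<open>I\<close>: \<open>convex_on\<close> includes convexity of its set, which the empty sum
  cannot supply.\<close>

lemma convex_on_finite_sum:
  assumes "finite I" and "convex S" and "\<And>i. i \<in> I \<Longrightarrow> convex_on S (f i)"
  shows "convex_on S (\<lambda>x. \<Sum>i\<in>I. f i x)"
  using assms(1,3)
  by induction (auto simp: convex_on_const assms(2))

lemma convex_sublevel:
  assumes "convex_on S f"
  shows "convex {x \<in> S. f x \<le> c}"
  unfolding convex_def
proof clarify
  fix x y u v
  assume x: "x \<in> S" "f x \<le> c" and y: "y \<in> S" "f y \<le> c"
    and uv: "0 \<le> (u::real)" "0 \<le> v" "u + v = 1"
  have "u *\<^sub>R x + v *\<^sub>R y \<in> S"
    using convexD[OF convex_on_imp_convex[OF assms]] x y uv by blast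
  moreover have "f (u *\<^sub>R x + v *\<^sub>R y) \<le> u * f x + v * f y"
    using assms x y uv unfolding convex_on_def by blast
  moreover have "u * f x + v * f y \<le> c"
    using convex_bound_le[of "f x" c "f y" u v] x y uv by simp
  ultimately show "u *\<^sub>R x + v *\<^sub>R y \<in> S \<and> f (u *\<^sub>R x + v *\<^sub>R y) \<le> c"
    by simp
qed

lemma convex_on_inverse_power2: "convex_on {0<..} (\<lambda>x::real. 1 / x\<^sup>2)"
proof (rule f''_ge0_imp_convex)
  show "((\<lambda>x. 1 / x\<^sup>2) has_real_derivative - 2 / x ^ 3) (at x)" if "x \<in> {0<..}" for x :: real
    using that by (auto intro!: derivative_eq_intros simp: field_simps power2_eq_square power3_eq_cube)
  show "((\<lambda>x. - 2 / x ^ 3) has_real_derivative 6 / x ^ 4) (at x)" if "x \<in> {0<..}" for x :: real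
    using that by (auto intro!: derivative_eq_intros simp: field_simps power_numeral_reduce)
qed auto

lemma convex_on_quadratic_over_linear:
  "convex_on (UNIV \<times> {0<..}) (\<lambda>p :: real \<times> real. (fst p)\<^sup>2 / snd p)"
  unfolding convex_on_def
proof (intro conjI ballI allI impI)
  show "convex (UNIV \<times> {0::real<..} :: (real \<times> real) set)"
    by (intro convex_Times) auto
next
  fix p q :: "real \<times> real" and u v :: real
  assume pq: "p \<in> UNIV \<times> {0<..}" "q \<in> UNIV \<times> {0<..}" and uv: "0 \<le> u" "0 \<le> v" "u + v = 1"
  obtain x r y s where p: "p = (x, r)" and q: "q = (y, s)"
    by fastforce
  have r: "r > 0" and s: "s > 0"
    using pq p q by auto
  \<comment> \<open>One of the weights may be 0, so positivity is read off from the convexity of the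
    open half-line.\<close>
  have pos: "u * r + v * s > 0"
    using convexD[of "{0<..}" r s u v] r s uv by simp
  \<comment> \<open>Lagrange's identity: the gap in Cauchy-Schwarz is an explicit square. Dividing
    by \<open>u * r + v * s\<close> then gives the convexity inequality.\<close>
  have "(u * (x\<^sup>2 / r) + v * (y\<^sup>2 / s)) * (u * r + v * s) - (u * x + v * y)\<^sup>2
      = u * v * (x * s - y * r)\<^sup>2 / (r * s)"
    using r s by (simp add: field_simps power2_eq_square)
  also have "\<dots> \<ge> 0"
    using r s uv by simp
  finally have "(u * x + v * y)\<^sup>2 / (u * r + v * s) \<le> u * (x\<^sup>2 / r) + v * (y\<^sup>2 / s)"
    using pos by (simp add: pos_divide_le_eq)
  then show "(fst (u *\<^sub>R p + v *\<^sub>R q))\<^sup>2 / snd (u *\<^sub>R p + v *\<^sub>R q)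
      \<le> u * ((fst p)\<^sup>2 / snd p) + v * ((fst q)\<^sup>2 / snd q)"
    by (simp add: p q)
qed

lemma linear_fst_nth: "linear (\<lambda>z :: (real ^ 'k) \<times> 'b::real_vector. fst z $ k)"
  by (simp add: linear_iff)

lemma linear_snd_nth: "linear (\<lambda>z :: 'b::real_vector \<times> (real ^ 'k). snd z $ k)"
  by (simp add: linear_iff)

lemma P2_domainD:
  assumes "z \<in> P2_domain"
  shows "0 < fst z $ k" "fst z $ k \<le> 1" "0 < snd z $ k" "snd z $ k \<le> 1"
  using assms by (auto simp: P2_domain_def)

lemma convex_P2_domain: "convex (P2_domain :: 'k::finite vars set)"
proof -
  have "P2_domain = (\<Inter>k. ((\<lambda>z :: 'k vars. fst z $ k) -` {0<..1}) \<inter> ((\<lambda>z. snd z $ k) -` {0<..1}))"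
    by (auto simp: P2_domain_def)
  also have "convex \<dots>"
    by (intro convex_INT convex_Int convex_linear_vimage linear_fst_nth linear_snd_nth) auto
  finally show ?thesis .
qed

lemma convex_on_P2_objective:
  fixes D :: "'k::finite \<Rightarrow> real"
  assumes "\<And>k. D k \<ge> 0"
  shows "convex_on P2_domain (P2_objective D)"
proof -
  have "convex_on P2_domain
      (\<lambda>z. \<Sum>k\<in>UNIV. D k / (\<Sum>j\<in>UNIV. D j) * (1 / (fst z $ k)\<^sup>2))"
  proof (intro convex_on_finite_sum convex_on_cmul convex_P2_domain)
    fix k
    \<comment> \<open>If all \<open>D j\<close> vanish, the quotient is \<open>0 / 0 = 0\<close>, so
      no positive total is required.\<close>
    show "0 \<le> D k / (\<Sum>j\<in>UNIV. D j)"
      by (simp add: assms sum_nonneg)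
    show "convex_on P2_domain (\<lambda>z :: 'k vars. 1 / (fst z $ k)\<^sup>2)"
      by (rule convex_on_linear_vimage[OF convex_on_inverse_power2 linear_fst_nth convex_P2_domain])
        (rule image_subsetI, simp add: P2_domainD)
  qed auto
  then show ?thesis
    by (simp add: P2_objective_def case_prod_unfold)
qed

text \<open>The common shape of C1 and C2, with \<open>a\<close> and \<open>b\<close> collecting the
  constants of device \<open>k\<close>. The projection to the pair of coordinates of
  \<open>k\<close> is linear and maps the domain into the half-plane where the quadratic-over-linear
  function is convex.\<close>

lemma convex_P2_sublevel:
  fixes k :: "'k::finite"
  assumes "a \<ge> 0" and "b \<ge> 0"
  shows "convex {z \<in> P2_domain. a * ((fst z $ k)\<^sup>2 / snd z $ k) + b * (fst z $ k)\<^sup>2 \<le> c}"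
proof (intro convex_sublevel convex_on_add convex_on_cmul assms)
  have "linear (\<lambda>z :: 'k vars. (fst z $ k, snd z $ k))"
    by (simp add: linear_iff)
  moreover have "(\<lambda>z :: 'k vars. (fst z $ k, snd z $ k)) ` P2_domain \<subseteq> UNIV \<times> {0<..}"
    by (rule image_subsetI) (simp add: P2_domainD)
  ultimately show "convex_on P2_domain (\<lambda>z :: 'k vars. (fst z $ k)\<^sup>2 / snd z $ k)"
    using convex_on_linear_vimage[OF convex_on_quadratic_over_linear _ convex_P2_domain] by fastforce
  show "convex_on P2_domain (\<lambda>z :: 'k vars. (fst z $ k)\<^sup>2)"
    by (rule convex_on_linear_vimage[OF convex_power2 linear_fst_nth convex_P2_domain]) simp
qed

lemma convex_P2_C1:
  fixes D R_dl R_ul f :: "'k::finite \<Rightarrow> real"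
  assumes "D k \<ge> 0" and "M_ori \<ge> 0" and "C_ori \<ge> 0" and "Q \<ge> 0" and "B \<ge> 0"
    and "R_dl k \<ge> 0" and "R_ul k \<ge> 0" and "f k \<ge> 0"
  shows "convex {z \<in> P2_domain. P2_C1 M_ori C_ori Q B D R_dl R_ul f T0 k z}"
proof -
  \<comment> \<open>Factors are only regrouped and nothing is cancelled, so the equivalence holds
    for every \<open>z\<close>, even where a denominator is 0.\<close>
  have "P2_C1 M_ori C_ori Q B D R_dl R_ul f T0 k z \<longleftrightarrow>
      (M_ori * Q / B * (1 / R_dl k + 1 / R_ul k)) * ((fst z $ k)\<^sup>2 / snd z $ k)
        + (C_ori * D k / f k) * (fst z $ k)\<^sup>2 \<le> T0" for z
    by (simp add: P2_C1_def case_prod_unfold ac_simps)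
  then show ?thesis
    using assms by (simp only:) (intro convex_P2_sublevel; simp)
qed

lemma convex_P2_C2:
  fixes D R_ul P_ul f \<Omega> \<xi> E0 :: "'k::finite \<Rightarrow> real"
  assumes "D k \<ge> 0" and "M_ori \<ge> 0" and "C_ori \<ge> 0" and "Q \<ge> 0" and "B \<ge> 0"
    and "R_ul k \<ge> 0" and "P_ul k \<ge> 0" and "\<Omega> k \<ge> 0"
  shows "convex {z \<in> P2_domain. P2_C2 M_ori C_ori Q B D R_ul P_ul f \<Omega> \<xi> E0 k z}"
proof -
  \<comment> \<open>The circuit energy \<open>\<xi> k\<close> does not depend on \<open>z\<close>
    and joins the bound on the right.\<close>
  have "P2_C2 M_ori C_ori Q B D R_ul P_ul f \<Omega> \<xi> E0 k z \<longleftrightarrow>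
      (M_ori * Q * P_ul k / (B * R_ul k)) * ((fst z $ k)\<^sup>2 / snd z $ k)
        + (C_ori * \<Omega> k * D k * (f k)\<^sup>2) * (fst z $ k)\<^sup>2 \<le> E0 k - \<xi> k" for z
    by (simp add: P2_C2_def case_prod_unfold le_diff_eq ac_simps)
  then show ?thesis
    using assms by (simp only:) (intro convex_P2_sublevel; simp)
qed

lemma convex_P2_C3: "convex {z \<in> P2_domain. P2_C3 (k::'k::finite) z}"
proof -
  have "linear (\<lambda>z :: 'k vars. \<Sum>j\<in>UNIV. snd z $ j)"
    by (intro linear_compose_sum ballI linear_snd_nth)
  moreover have "{z \<in> P2_domain. P2_C3 k z} =
      P2_domain \<inter> (\<lambda>z. \<Sum>j\<in>UNIV. snd z $ j) -` {..1} \<inter> (\<lambda>z. snd z $ k) -` {0..}"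
    by (auto simp: P2_C3_def)
  ultimately show ?thesis
    by (auto intro!: convex_Int convex_linear_vimage convex_P2_domain linear_snd_nth)
qed

text \<open>The function \<open>1 - (x $ k)\<^sup>2\<close> is concave, so
  \<open>convex_sublevel\<close> does not apply; instead the feasible set is the domain cut by an
  open half-space.\<close>

lemma convex_P2_C4:
  assumes "\<theta> \<le> 1"
  shows "convex {z \<in> P2_domain. P2_C4 \<theta> (k::'k::finite) z}"
proof -
  have "P2_C4 \<theta> k z \<longleftrightarrow> sqrt (1 - \<theta>) < fst z $ k" if "z \<in> P2_domain" for z
  proof -
    have x: "0 < fst z $ k" "fst z $ k \<le> 1"
      using P2_domainD[OF that] by auto
    \<comment> \<open>Monotonicity of \<open>sqrt\<close> together with
      \<open>sqrt (x\<^sup>2) = x\<close> for positive \<open>x\<close>. The other half of C4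
      follows from the upper bound 1 on the domain.\<close>
    then have "sqrt (1 - \<theta>) < fst z $ k \<longleftrightarrow> 1 - \<theta> < (fst z $ k)\<^sup>2"
      using real_sqrt_less_iff[of "1 - \<theta>" "(fst z $ k)\<^sup>2"] by simp
    with x show ?thesis
      by (auto simp: P2_C4_def case_prod_unfold power_le_one)
  qed
  then have "{z \<in> P2_domain. P2_C4 \<theta> k z} =
      P2_domain \<inter> (\<lambda>z. fst z $ k) -` {sqrt (1 - \<theta>)<..}"
    by auto
  then show ?thesis
    by (auto intro!: convex_Int convex_linear_vimage convex_P2_domain linear_fst_nth)
qed

theorem lemma3:
  fixes D R_dl R_ul P_ul f \<Omega> \<xi> E0 :: "'k::finite \<Rightarrow> real"
    and M_ori C_ori Q B T0 \<theta> :: real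
  assumes "\<And>k. D k > 0"
    and "M_ori > 0" and "C_ori > 0" and "Q > 0" and "B > 0"
    and "\<And>k. R_dl k > 0" and "\<And>k. R_ul k > 0"
    and "\<And>k. P_ul k \<ge> 0"
    and "\<And>k. f k > 0" and "\<And>k. \<Omega> k > 0" and "\<And>k. \<xi> k \<ge> 0"
    and "T0 > 0" and "\<And>k. E0 k > 0"
    and "0 < \<theta>" and "\<theta> \<le> 1"
  shows "convex_optimization_problem P2_domain (P2_objective D)
    (range (P2_C1 M_ori C_ori Q B D R_dl R_ul f T0)
      \<union> range (P2_C2 M_ori C_ori Q B D R_ul P_ul f \<Omega> \<xi> E0)
      \<union> range P2_C3
      \<union> range (P2_C4 \<theta>))"
proof -
  show ?thesis
    unfolding convex_optimization_problem_def
    using assms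
    \<comment> \<open>One goal arises for the objective and one per constraint family at an
      arbitrary device; \<open>less_imp_le\<close> weakens the strict signs to those the lemmas ask
      for.\<close>
    by (auto intro!: convex_on_P2_objective convex_P2_C1 convex_P2_C2 convex_P2_C3 convex_P2_C4
        intro: less_imp_le)
qed

end
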